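(* For every fixed integer $D\ge 2$ there exists $n_0$ such that for all $n>n_0$, every tree $T$ of order $n$ and diameter at most $D$ satisfies $$d(C(T),CT(T))\le\left\lfloor\frac{D-2}{2}\right\rfloor,$$ and this bound is achieved by a $D$-comet (of order $n$).
   Context: For vertices $u,v$ of a tree $T$, $d(u,v)$ is the number of edges on the unique path joining them. The eccentricity of $v$ is $ecc_T(v)=\max_{u\in V(T)}d(v,u)$, and the center $C(T)$ is the set of vertices of minimum eccentricity. The distance of $v$ is $d_T(v)=\sum_{u\in V(T)}d(v,u)$, and the centroid $CT(T)$ is the set of vertices minimizing $d_T$. For vertex sets $S,S'$, $d(S,S')=\min\{d(u,v):u\in S,\ v\in S'\}$. An $r$-comet of order $n$ is the tree formed by attaching $n-r$ pendant vertices to one end vertex of a path on $r$ vertices. *)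

theory Defs
  imports "Graph_Theory.Graph_Theory"
begin

text \<open>
  A finite simple graph is a \<^locale>\<open>pair_graph\<close>: each undirected edge is the pair of its two
  opposite arcs.  The library predicate \<^const>\<open>Digraph_Component.tree\<close> is not the notion of an
  undirected tree here: its \<^const>\<open>Digraph_Component.forest\<close> part forbids all
  directed cycles, so already a single undirected edge, traversed back and forth, is excluded.
  In a loop-free graph without parallel arcs such a back-and-forth walk is exactly a cycle
  of length 2, and the cycles of the undirected graph are those of length at least 3.
\<close>

definition simple_tree :: "'a pair_pre_digraph \<Rightarrow> bool" where
  "simple_tree T \<longleftrightarrow>
     pair_graph T \<and> Digraph_Component.connected (with_proj T) \<and>
     \<not> (\<exists>p. pre_digraph.cycle (with_proj T) p \<and> 3 \<le> length p)"

text \<open>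
  A path \<open>p\<close> is its list of arcs, so its length is the number of edges.  The definite
  description is meaningful for vertices of a tree, where the path is unique.
\<close>

definition tree_dist :: "'a pair_pre_digraph \<Rightarrow> 'a \<Rightarrow> 'a \<Rightarrow> nat" where
  "tree_dist T u v = length (THE p. pre_digraph.apath (with_proj T) u p v)"

definition ecc :: "'a pair_pre_digraph \<Rightarrow> 'a \<Rightarrow> nat" where
  "ecc T v = Max {tree_dist T v u | u. u \<in> pverts T}"

definition tree_diameter :: "'a pair_pre_digraph \<Rightarrow> nat" where
  "tree_diameter T = Max {tree_dist T u v | u v. u \<in> pverts T \<and> v \<in> pverts T}"

definition center :: "'a pair_pre_digraph \<Rightarrow> 'a set" where
  "center T = {v \<in> pverts T. \<forall>u \<in> pverts T. ecc T v \<le> ecc T u}"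

definition vertex_distance :: "'a pair_pre_digraph \<Rightarrow> 'a \<Rightarrow> nat" where
  "vertex_distance T v = (\<Sum>u \<in> pverts T. tree_dist T v u)"

definition centroid :: "'a pair_pre_digraph \<Rightarrow> 'a set" where
  "centroid T = {v \<in> pverts T. \<forall>u \<in> pverts T. vertex_distance T v \<le> vertex_distance T u}"

definition set_dist :: "'a pair_pre_digraph \<Rightarrow> 'a set \<Rightarrow> 'a set \<Rightarrow> nat" where
  "set_dist T S S' = Min {tree_dist T u v | u v. u \<in> S \<and> v \<in> S'}"

text \<open>
  The \<open>r\<close>-comet of order \<open>n\<close>, for \<open>1 \<le> r \<le> n\<close>: the path is \<open>0, 1, \<dots>, r - 1\<close>, and the
  pendant vertices \<open>r, \<dots>, n - 1\<close> are attached to its end vertex \<open>r - 1\<close>.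
\<close>

definition comet :: "nat \<Rightarrow> nat \<Rightarrow> nat pair_pre_digraph" where
  "comet r n =
     (let E = {(i, Suc i) | i. Suc i < r} \<union> {r - 1} \<times> {r..<n}
      in \<lparr> pverts = {..<r} \<union> {r..<n}, parcs = E \<union> E\<inverse> \<rparr>)"

end

theory Submission
  imports Defs
begin

text \<open>
  In a tree, removing an edge separates the vertices into two sides, and the distance between
  vertices on different sides is the sum of their distances to the two ends of the edge, plus one
  (\<open>dist_across_arc\<close>).  The proof uses this fact about paths, and parity in the form that the
  distances from a vertex to the two ends of an edge always differ by exactly one
  (\<open>dist_arc_cases\<close>).

  Upper bound.  Take a centroid vertex \<open>x\<close> and a center vertex \<open>c\<close> closest to it, at distance
  \<open>m\<close>, where only \<open>m > 0\<close> needs an argument.  A centroid vertex of a tree with at least three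
  vertices is not a leaf, so the path from \<open>c\<close> to \<open>x\<close> can be prolonged
  beyond \<open>x\<close> to a vertex \<open>y\<close> with \<open>d c y \<ge> m + 1\<close>; in particular
  the eccentricity of \<open>c\<close> is at least \<open>m + 1\<close>.  The neighbour \<open>a\<close> of \<open>c\<close> towards \<open>x\<close> is closer
  to \<open>x\<close>, hence not in the center, hence of larger eccentricity than \<open>c\<close>.  A vertex \<open>w\<close> farthest
  from \<open>a\<close> therefore lies on the side of \<open>c\<close> and is at distance \<open>ecc c\<close> from it.  Passing from
  \<open>w\<close> through \<open>c\<close> to \<open>y\<close> gives two vertices at distance at least \<open>2 * (m + 1)\<close>, so
  \<open>2 * m + 2 \<le> D\<close>.

  Sharpness.  In the comet, call \<open>min v D\<close> the level of \<open>v\<close>: it is the distance from the free end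
  \<open>0\<close> of the path, and all pendant vertices have level \<open>D\<close>.  The eccentricity is the larger of
  level and \<open>D - level\<close>, so the center sits at the middle levels.  The hub
  \<open>D - 1\<close> is adjacent to all pendant vertices, while every other vertex is at distance at least 2
  from all of them but possibly itself.  With enough pendant vertices this outweighs the bounded
  contribution of the path, and the hub is the only centroid vertex.
\<close>

section \<open>The metric of a tree\<close>

locale undirected_tree = pair_graph G for G :: "'a pair_pre_digraph" +
  assumes connected: "Digraph_Component.connected (with_proj G)"
    and cycle_short: "cycle p \<Longrightarrow> length p < 3"

lemma undirected_tree_iff: "undirected_tree G \<longleftrightarrow> simple_tree G"
  unfolding simple_tree_def undirected_tree_def undirected_tree_axioms_def
  by (auto simp: not_le)

context undirected_tree
begin

abbreviation d :: "'a \<Rightarrow> 'a \<Rightarrow> nat" where "d \<equiv> tree_dist G"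

lemma ex_apath:
  assumes "u \<in> pverts G" "v \<in> pverts G"
  shows "\<exists>p. apath u p v"
proof -
  have "u \<rightarrow>\<^sup>*\<^bsub>with_proj (mk_symmetric G)\<^esub> v"
    using connected assms
    by (simp add: Digraph_Component.connected_def Digraph_Component.strongly_connected_def)
  then show ?thesis
    using reachable_mk_symmetric_eq[OF pair_sym_arcs] reachable_apath by simp
qed

lemma ex_apath_within:
  assumes "awalk u p v"
  obtains q where "apath u q v" "set (awalk_verts u q) \<subseteq> set (awalk_verts u p)" "length q \<le> length p"
proof
  let ?q = "awalk_to_apath p"
  show a: "apath u ?q v" using assms by (rule apath_awalk_to_apath)
  have s: "set ?q \<subseteq> set p" using assms by (rule awalk_to_apath_subset)
  show "set (awalk_verts u ?q) \<subseteq> set (awalk_verts u p)"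
    unfolding set_awalk_verts[OF assms] set_awalk_verts[OF awalkI_apath[OF a]] set_map
    using image_mono[OF s, of fst] image_mono[OF s, of snd] by blast
  have "distinct ?q" using a distinct_verts_imp_distinct by (auto simp: apath_def)
  then have "length ?q = card (set ?q)" by (simp add: distinct_card)
  also have "\<dots> \<le> card (set p)" using s by (intro card_mono) auto
  also have "\<dots> \<le> length p" by (rule card_length)
  finally show "length ?q \<le> length p" .
qed

text \<open>A path joining the ends of an edge other than the edge itself would close up to a cycle.\<close>

lemma apath_along_arc:
  assumes "(u, a) \<in> parcs G" "apath u p a"
  shows "length p \<le> 1"
proof -
  from assms(1) have au: "(a, u) \<in> parcs G" by (rule arcs_symmetric)
  have "awalk a ((a, u) # p) a" using assms au by (auto simp: awalk_Cons_iff apath_def)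
  then have "cycle ((a, u) # p)" using assms(2) by (auto simp: cycle_def apath_def)
  then show ?thesis using cycle_short by force
qed

text \<open>
  If two paths from \<open>u\<close> to \<open>v\<close> start with different edges, to \<open>a\<close> and to \<open>b\<close>, then going from \<open>a\<close>
  to \<open>v\<close> and back to \<open>b\<close> avoids \<open>u\<close>, which gives a path from \<open>u\<close> via \<open>a\<close> to its neighbour \<open>b\<close>.
\<close>

lemma apath_unique:
  assumes "apath u p v" "apath u q v"
  shows "p = q"
  using assms
proof (induction p arbitrary: u q)
  case Nil
  then show ?case using apath_ends by blast
next
  case (Cons e p')
  obtain f q' where q: "q = f # q'"
    using Cons.prems apath_nonempty_ends[OF Cons.prems(1)] by (cases q) (auto simp: apath_Nil_iff)
  obtain a where e: "e = (u, a)" and p': "apath a p' v" "u \<notin> set (awalk_verts a p')"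
    and ua: "(u, a) \<in> parcs G"
    using Cons.prems by (cases e) (auto simp: apath_Cons_iff)
  obtain b where f: "f = (u, b)" and q': "apath b q' v" "u \<notin> set (awalk_verts b q')"
    and ub: "(u, b) \<in> parcs G"
    using Cons.prems q by (cases f) (auto simp: apath_Cons_iff)
  have "a = b"
  proof (rule ccontr)
    assume "a \<noteq> b"
    have r: "awalk v (rev_path q') b" "u \<notin> set (awalk_verts v (rev_path q'))"
      using q' by (auto simp: apath_def awalk_verts_rev_path)
    have w: "awalk a (p' @ rev_path q') b"
      using p' r by (intro awalk_appendI) (auto simp: apath_def)
    moreover have "u \<notin> set (awalk_verts a (p' @ rev_path q'))"
      using p' r set_awalk_verts_append[of a p' v "rev_path q'" b] by (auto simp: apath_def)
    ultimately obtain s where s: "apath a s b" "u \<notin> set (awalk_verts a s)"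
      using ex_apath_within[OF w] by blast
    then have "apath u ((u, a) # s) b" using ua by (simp add: apath_Cons_iff)
    then have "length ((u, a) # s) \<le> 1" using ub apath_along_arc by blast
    then have "s = []" by simp
    then show False using s \<open>a \<noteq> b\<close> by (simp add: apath_Nil_iff)
  qed
  then show ?case using Cons.IH p' q' e f q by simp
qed

lemma dist_apath:
  assumes "apath u p v"
  shows "d u v = length p"
proof -
  have "(THE q. apath u q v) = p"
    using assms apath_unique by blast
  then show ?thesis by (simp add: tree_dist_def)
qed

lemma dist_le_awalk:
  assumes "awalk u p v"
  shows "d u v \<le> length p"
  using ex_apath_within[OF assms] dist_apath by metis

lemma dist_self: "u \<in> pverts G \<Longrightarrow> d u u = 0"
  using dist_apath[of u "[]" u] by (simp add: apath_Nil_iff)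

lemma dist_pos: "u \<in> pverts G \<Longrightarrow> v \<in> pverts G \<Longrightarrow> u \<noteq> v \<Longrightarrow> 0 < d u v"
  using ex_apath[of u v] dist_apath by (auto simp: apath_Nil_iff)

lemma dist_sym:
  assumes "u \<in> pverts G" "v \<in> pverts G"
  shows "d u v = d v u"
proof -
  obtain p where p: "apath u p v" using ex_apath assms by blast
  then have "apath v (rev_path p) u" by simp
  moreover have "length (rev_path p) = length p" by (induction p) auto
  ultimately show ?thesis using p dist_apath by metis
qed

lemma dist_triangle:
  assumes "u \<in> pverts G" "v \<in> pverts G" "w \<in> pverts G"
  shows "d u w \<le> d u v + d v w"
proof -
  obtain p q where "apath u p v" "apath v q w" using ex_apath assms by blast
  moreover from this have "awalk u (p @ q) w" by (intro awalk_appendI) (auto simp: apath_def)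
  ultimately show ?thesis using dist_le_awalk[of u "p @ q" w] dist_apath by simp
qed

lemma dist_arc_le: "(u, v) \<in> parcs G \<Longrightarrow> d u v \<le> 1"
  using dist_le_awalk[of u "[(u, v)]" v] by (auto simp: awalk_simps wellformed')

lemma ex_first_step:
  assumes "u \<in> pverts G" "v \<in> pverts G" "u \<noteq> v"
  obtains a where "(u, a) \<in> parcs G" "a \<in> pverts G" "d u v = Suc (d a v)"
proof -
  obtain p where p: "apath u p v" using ex_apath assms by blast
  with assms obtain e q where pe: "p = e # q" by (cases p) (auto simp: apath_Nil_iff)
  with p obtain a where "e = (u, a)" "(u, a) \<in> parcs G" "apath a q v"
    by (cases e) (auto simp: apath_Cons_iff)
  with p pe that show ?thesis using dist_apath wellformed' by simp
qed

text \<open>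
  The path from \<open>a\<close> to \<open>u\<close> either starts with the edge to \<open>b\<close>, or it avoids \<open>b\<close> and extends to a
  path from \<open>b\<close>.  This says on which side of the edge \<open>u\<close> lies.
\<close>

lemma dist_arc_cases:
  assumes "(a, b) \<in> parcs G" "u \<in> pverts G"
  shows "d a u = Suc (d b u) \<or> d b u = Suc (d a u)"
proof -
  obtain p where p: "apath a p u" using ex_apath assms wellformed' by blast
  show ?thesis
  proof (cases "b \<in> set (awalk_verts a p)")
    case True
    then obtain q r where qr: "p = q @ r" "awalk a q b" "awalk b r u"
      using awalk_decomp[OF awalkI_apath[OF p] True] by blast
    then have ap: "apath a q b" "apath b r u" using p
      by (auto simp: apath_append_iff)
    have "length q \<le> 1" using ap assms apath_along_arc by blast
    moreover have "q \<noteq> []" using ap no_loops' assms by (auto simp: apath_Nil_iff)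
    ultimately have "length q = 1" by (cases q) auto
    then show ?thesis using dist_apath[OF p] dist_apath[OF ap(2)] qr by simp
  next
    case False
    then have "apath b ((b, a) # p) u"
      using p arcs_symmetric[OF assms(1)] by (simp add: apath_Cons_iff)
    then show ?thesis using dist_apath[OF p] dist_apath by force
  qed
qed

text \<open>
  The paths from \<open>w\<close> to \<open>a\<close> and from \<open>b\<close> to \<open>y\<close> stay on their side of the edge, so they are
  disjoint: by the triangle inequality a common vertex would be nearer to \<open>a\<close> than to \<open>b\<close>, being
  on a shortest path from \<open>w\<close>, and also nearer to \<open>b\<close> than to \<open>a\<close>.
\<close>

lemma dist_across_arc:
  assumes ab: "(a, b) \<in> parcs G" and "w \<in> pverts G" "y \<in> pverts G"
    and w: "d b w = Suc (d a w)" and y: "d a y = Suc (d b y)"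
  shows "d w y = Suc (d w a + d b y)"
proof -
  have V: "a \<in> pverts G" "b \<in> pverts G" using ab wellformed' by auto
  obtain p q where p: "apath w p a" and q: "apath b q y"
    using ex_apath assms V by blast
  have disj: "z \<notin> set (awalk_verts b q)" if z: "z \<in> set (awalk_verts w p)" for z
  proof
    assume z': "z \<in> set (awalk_verts b q)"
    obtain p1 p2 where p12: "p = p1 @ p2" "awalk w p1 z" "awalk z p2 a"
      using awalk_decomp[OF awalkI_apath[OF p] z] by blast
    obtain q1 q2 where q12: "q = q1 @ q2" "awalk b q1 z" "awalk z q2 y"
      using awalk_decomp[OF awalkI_apath[OF q] z'] by blast
    have zV: "z \<in> pverts G" using p12 by (auto simp: awalk_last_in_verts)
    have "d w z + d z a \<le> d w a" "d b z + d z y \<le> d b y"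
      using dist_le_awalk p12 q12 dist_apath[OF p] dist_apath[OF q] by (auto intro: add_mono)
    moreover have "d b w \<le> d b z + d z w" "d a y \<le> d a z + d z y"
      using dist_triangle[of b z w] dist_triangle[of a z y] V zV assms by simp_all
    ultimately show False
      using w y dist_sym V zV assms(2,3) by simp
  qed
  have last: "awlast w p = a" using p by (auto simp: apath_def)
  have "a \<in> set (awalk_verts w p)"
    using hd_in_awalk_verts(2)[of a "rev_path p" w] awalk_verts_rev_path[of w p a] p
    by (simp add: apath_def)
  then have "apath a ((a, b) # q) y" using q ab disj by (simp add: apath_Cons_iff)
  then have "apath w (p @ (a, b) # q) y"
    using p disj last by (auto simp: apath_append_iff)
  then show ?thesis using dist_apath p q by fastforce
qed

text \<open>
  A potential that changes by at most one along each edge bounds distances from below, which spares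
  determining the paths themselves.
\<close>

lemma lipschitz_le_dist:
  fixes f :: "'a \<Rightarrow> nat"
  assumes f: "\<And>a b. (a, b) \<in> parcs G \<Longrightarrow> f a \<le> Suc (f b)"
    and "u \<in> pverts G" "v \<in> pverts G"
  shows "f u \<le> f v + d u v"
proof -
  have "f u \<le> f v + length p" if "awalk u p v" for p u
    using that
  proof (induction p arbitrary: u)
    case (Cons e p)
    then obtain a where "e = (u, a)" "(u, a) \<in> parcs G" "awalk a p v"
      by (cases e) (auto simp: awalk_Cons_iff)
    then show ?case using Cons.IH[of a] f[of u a] by simp
  qed (simp add: awalk_Nil_iff)
  moreover obtain p where "apath u p v" using ex_apath assms by blast
  ultimately show ?thesis using dist_apath awalkI_apath by metis
qed

lemma finite_dists:
  "finite {d v u |u. u \<in> pverts G}" "finite {d u v |u v. u \<in> pverts G \<and> v \<in> pverts G}"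
proof -
  show "finite {d v u |u. u \<in> pverts G}" by simp
  show "finite {d u v |u v. u \<in> pverts G \<and> v \<in> pverts G}"
    using finite_image_set2[of "\<lambda>u. u \<in> pverts G" "\<lambda>v. v \<in> pverts G" d] by simp
qed

lemma dist_le_ecc: "u \<in> pverts G \<Longrightarrow> d v u \<le> ecc G v"
  unfolding ecc_def using finite_dists by (intro Max_ge) auto

lemma ex_eccentric:
  assumes "v \<in> pverts G"
  obtains u where "u \<in> pverts G" "d v u = ecc G v"
proof -
  have "ecc G v \<in> {d v u |u. u \<in> pverts G}"
    unfolding ecc_def using finite_dists assms by (intro Max_in) auto
  then show ?thesis using that by auto
qed

lemma dist_le_diameter:
  assumes "u \<in> pverts G" "v \<in> pverts G"
  shows "d u v \<le> tree_diameter G"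
  unfolding tree_diameter_def using finite_dists assms by (intro Max_ge) auto

section \<open>Center and centroid of an arbitrary tree\<close>

lemma pverts_nonempty: "pverts G \<noteq> {}"
  using connected by (simp add: Digraph_Component.connected_def Digraph_Component.strongly_connected_def)

lemma center_nonempty: "center G \<noteq> {}"
proof -
  obtain v where "v \<in> pverts G" "\<And>u. u \<in> pverts G \<Longrightarrow> ecc G v \<le> ecc G u"
    using pverts_nonempty
    by (metis (mono_tags, lifting) arg_min_if_finite(1) arg_min_least pair_finite_verts)
  then show ?thesis by (auto simp: center_def)
qed

lemma centroid_nonempty: "centroid G \<noteq> {}"
proof -
  obtain v where "v \<in> pverts G" "\<And>u. u \<in> pverts G \<Longrightarrow> vertex_distance G v \<le> vertex_distance G u"
    using pverts_nonempty
    by (metis (mono_tags, lifting) arg_min_if_finite(1) arg_min_least pair_finite_verts)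
  then show ?thesis by (auto simp: centroid_def)
qed

text \<open>
  If no vertex other than \<open>x\<close> lay beyond \<open>x\<close> as seen from \<open>p\<close>, then moving from \<open>x\<close> to \<open>p\<close> would
  bring all other vertices one step nearer while only \<open>x\<close> itself gets farther, so \<open>p\<close> would have
  the smaller distance sum.
\<close>

lemma centroid_not_leaf:
  assumes x: "x \<in> centroid G" and px: "(p, x) \<in> parcs G" and n: "3 \<le> card (pverts G)"
  obtains y where "y \<in> pverts G" "y \<noteq> x" "d p y = Suc (d x y)"
proof -
  have V: "p \<in> pverts G" "x \<in> pverts G" using px wellformed' by auto
  have "\<exists>y \<in> pverts G - {x}. d p y = Suc (d x y)"
  proof (rule ccontr)
    assume "\<not> ?thesis"
    then have "d x u = Suc (d p u)" if "u \<in> pverts G - {x}" for u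
      using that dist_arc_cases[OF px, of u] by auto
    then have "(\<Sum>u \<in> pverts G - {x}. d x u) = (\<Sum>u \<in> pverts G - {x}. Suc (d p u))"
      by (intro sum.cong) auto
    also have "\<dots> = (\<Sum>u \<in> pverts G - {x}. d p u) + (card (pverts G) - 1)"
      using V by (simp add: sum.distrib[of _ "\<lambda>_. 1", simplified] sum_Suc)
    finally have "vertex_distance G x = (\<Sum>u \<in> pverts G - {x}. d p u) + (card (pverts G) - 1)"
      using V dist_self by (simp add: vertex_distance_def sum.remove[of _ x])
    moreover have "vertex_distance G p \<le> 1 + (\<Sum>u \<in> pverts G - {x}. d p u)"
      using V dist_arc_le[OF px] by (simp add: vertex_distance_def sum.remove[of _ x])
    moreover have "vertex_distance G x \<le> vertex_distance G p"
      using x V by (simp add: centroid_def)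
    ultimately show False using n by simp
  qed
  then show ?thesis using that by blast
qed

text \<open>
  The heart of the upper bound: minimality of \<open>d c x\<close> makes the next vertex towards \<open>x\<close> strictly
  more eccentric than \<open>c\<close>, which produces a farthest vertex behind \<open>c\<close> to set against a vertex
  beyond \<open>x\<close>.
\<close>

lemma closest_center_centroid:
  assumes n: "3 \<le> card (pverts G)"
    and c: "c \<in> center G" and x: "x \<in> centroid G" and "c \<noteq> x"
    and closest: "\<And>c'. c' \<in> center G \<Longrightarrow> d c x \<le> d c' x"
  shows "2 * d c x + 2 \<le> tree_diameter G"
proof -
  have V: "c \<in> pverts G" "x \<in> pverts G" using c x by (auto simp: center_def centroid_def)
  obtain p where p: "(x, p) \<in> parcs G" "p \<in> pverts G" "d x c = Suc (d p c)"
    using ex_first_step V \<open>c \<noteq> x\<close> by metis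
  have px: "(p, x) \<in> parcs G" using p arcs_symmetric by blast
  obtain y where y: "y \<in> pverts G" "y \<noteq> x" "d p y = Suc (d x y)"
    using centroid_not_leaf[OF x px n] by blast
  have cy: "d c y = d c x + d x y"
    using dist_across_arc[OF px V(1) y(1) p(3) y(3)] p dist_sym V by simp
  have xy: "0 < d x y" using dist_pos V y by auto
  obtain a where a: "(c, a) \<in> parcs G" "a \<in> pverts G" "d c x = Suc (d a x)"
    using ex_first_step V \<open>c \<noteq> x\<close> by metis
  \<comment> \<open>\<open>a\<close> is the next vertex on the way from \<open>c\<close> to \<open>x\<close>, hence also to \<open>y\<close>.\<close>
  have "d a y \<le> d a x + d x y" using dist_triangle a V y by blast
  then have ay: "d c y = Suc (d a y)"
    using dist_arc_cases[OF a(1) y(1)] cy a(3) by auto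
  have "a \<notin> center G" using closest[of a] a by auto
  then have ecc: "ecc G c < ecc G a"
    using c a V by (force simp: center_def not_le)
  obtain w where w: "w \<in> pverts G" "d a w = ecc G a" using ex_eccentric a by blast
  \<comment> \<open>No vertex is that far from \<open>c\<close>, so \<open>w\<close> lies on the side of \<open>c\<close>.\<close>
  have aw: "d a w = Suc (d c w)"
    using dist_arc_cases[OF a(1) w(1)] dist_le_ecc[OF w(1), of c] ecc w(2) by auto
  have "d w y = d w c + d c y"
    using dist_across_arc[OF a(1) w(1) y(1) aw ay] ay by simp
  moreover have "d c y \<le> d w c"
    using dist_le_ecc[OF y(1), of c] ecc w aw dist_sym[OF V(1) w(1)] by simp
  moreover have "d w y \<le> tree_diameter G" using dist_le_diameter w y by blast
  ultimately show ?thesis using cy xy by simp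
qed

lemma set_dist_center_centroid_le:
  assumes n: "3 \<le> card (pverts G)" and D: "tree_diameter G \<le> D"
  shows "set_dist G (center G) (centroid G) \<le> (D - 2) div 2"
proof -
  obtain x where x: "x \<in> centroid G" using centroid_nonempty by blast
  obtain c where c: "c \<in> center G" "\<And>c'. c' \<in> center G \<Longrightarrow> d c x \<le> d c' x"
    using ex_has_least_nat[of "\<lambda>c. c \<in> center G" _ "\<lambda>c. d c x"] center_nonempty by blast
  have "finite {d u v |u v. u \<in> center G \<and> v \<in> centroid G}"
    by (rule finite_subset[OF _ finite_dists(2)]) (auto simp: center_def centroid_def)
  then have "set_dist G (center G) (centroid G) \<le> d c x"
    unfolding set_dist_def using c x by (intro Min_le) auto
  also have "d c x \<le> (D - 2) div 2"
  proof (cases "c = x")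
    case True
    then show ?thesis using x dist_self by (simp add: centroid_def)
  next
    case False
    then show ?thesis using closest_center_centroid[OF n c(1) x False c(2)] D by linarith
  qed
  finally show ?thesis .
qed

end

section \<open>The comet\<close>

text \<open>
  The smaller neighbour is the parent of a vertex in a tree with root 0.  Following parents connects
  every vertex to the root.  On a cycle of length at least 3, the largest vertex would have
  two different smaller neighbours, its predecessor and its successor.
\<close>

lemma undirected_tree_if_unique_smaller_neighbour:
  fixes G :: "nat pair_pre_digraph"
  assumes "pair_graph G" and root: "0 \<in> pverts G"
    and parent: "\<And>v. v \<in> pverts G \<Longrightarrow> 0 < v \<Longrightarrow> \<exists>u<v. (v, u) \<in> parcs G"
    and parent_unique: "\<And>u u' v. (v, u) \<in> parcs G \<Longrightarrow> (v, u') \<in> parcs G \<Longrightarrow> u < v \<Longrightarrow> u' < v \<Longrightarrow> u = u'"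
  shows "undirected_tree G"
proof -
  interpret pair_graph G by fact
  have to_root: "v \<rightarrow>\<^sup>*\<^bsub>with_proj G\<^esub> 0" if "v \<in> pverts G" for v
    using that
  proof (induction v rule: less_induct)
    case (less v)
    show ?case
    proof (cases "v = 0")
      case False
      then obtain u where "u < v" "(v, u) \<in> parcs G" using parent less.prems by blast
      then show ?thesis using less.IH[of u] adj_reachable_trans[of v u 0] wellformed' by auto
    qed (use root in auto)
  qed
  have "u \<rightarrow>\<^sup>*\<^bsub>with_proj (mk_symmetric G)\<^esub> v" if "u \<in> pverts G" "v \<in> pverts G" for u v
    using to_root[OF that(1)] symmetric_reachable[OF pair_sym_arcs to_root[OF that(2)]]
      reachable_trans reachable_mk_symmetric_eq[OF pair_sym_arcs] by blast
  then have conn: "Digraph_Component.connected (with_proj G)"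
    using root by (auto simp: Digraph_Component.connected_def Digraph_Component.strongly_connected_def)
  have short: "length p < 3" if "cycle p" for p
  proof (rule ccontr)
    assume len: "\<not> length p < 3"
    obtain u where u: "awalk u p u" "distinct (tl (awalk_verts u p))" "p \<noteq> []"
      using \<open>cycle p\<close> by (auto simp: cycle_def)
    have heads: "tl (awalk_verts u p) = map snd p"
      using u awalk_verts_conv'[of u p u] by auto
    \<comment> \<open>\<open>h\<close> lists the vertices of the cycle once each; \<open>prv\<close> and \<open>nxt\<close> are the cyclic shifts of the
      positions.\<close>
    let ?L = "length p"
    define h where "h i = snd (p ! i)" for i
    define prv where "prv i = (if i = 0 then ?L - 1 else i - 1)" for i
    define nxt where "nxt i = (if i = ?L - 1 then 0 else Suc i)" for i
    have inj: "i = j" if "h i = h j" "i < ?L" "j < ?L" for i j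
      using that u(2) unfolding heads h_def by (auto simp: distinct_conv_nth)
    have tails: "fst (p ! i) = h (prv i)" if "i < ?L" for i
    proof (cases i)
      case 0
      have "fst (p ! 0) = u" using u by (cases p) (auto simp: awalk_Cons_iff)
      moreover have "h (?L - 1) = last (awalk_verts u p)"
        using u by (simp add: h_def awalk_verts_conv last_conv_nth)
      ultimately show ?thesis using 0 u by (simp add: prv_def)
    next
      case (Suc j)
      have "fst (p ! i) = awalk_verts u p ! i"
        using that by (auto simp: awalk_verts_conv nth_append)
      also have "\<dots> = tl (awalk_verts u p) ! j"
        using Suc that by (simp add: nth_tl length_awalk_verts)
      finally show ?thesis using Suc that by (simp add: heads h_def prv_def)
    qed
    have arc: "(h (prv i), h i) \<in> parcs G" if "i < ?L" for i
    proof -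
      have "p ! i \<in> parcs G" using that u nth_mem[of i p] by (auto simp: awalk_def)
      then show ?thesis using tails[OF that] by (metis h_def prod.collapse)
    qed
    have "Max (h ` {..<?L}) \<in> h ` {..<?L}" using u by (intro Max_in) auto
    then obtain m where "m < ?L" "h m = Max (h ` {..<?L})" by auto
    then have m: "m < ?L" "\<And>i. i < ?L \<Longrightarrow> h i \<le> h m" by auto
    have lt: "prv m < ?L" "nxt m < ?L" "prv (nxt m) = m" "prv m \<noteq> nxt m" "prv m \<noteq> m" "nxt m \<noteq> m"
      using m(1) len by (auto simp: prv_def nxt_def)
    have "(h m, h (prv m)) \<in> parcs G" "(h m, h (nxt m)) \<in> parcs G"
      using arc[of m] arc[of "nxt m"] lt m(1) arcs_symmetric by auto
    moreover have "h (prv m) < h m" "h (nxt m) < h m"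
      using m lt inj by (metis le_neq_implies_less)+
    ultimately have "h (prv m) = h (nxt m)" by (rule parent_unique)
    then show False using inj lt by blast
  qed
  show ?thesis by unfold_locales (use conn short in auto)
qed

lemma pverts_comet: "D \<le> n \<Longrightarrow> pverts (comet D n) = {..<n}"
  by (auto simp: comet_def Let_def)

text \<open>
  An edge leads from level \<open>l\<close> to level \<open>l + 1\<close>.  The vertex on the lower level is below \<open>D\<close> and
  equals its level, so levels alone determine adjacency.
\<close>

lemma parcs_comet:
  assumes "0 < D" "D \<le> n"
  shows "(a, b) \<in> parcs (comet D n) \<longleftrightarrow> a < n \<and> b < n \<and> (min b D = Suc a \<or> min a D = Suc b)"
  using assms by (auto simp: comet_def Let_def min_def)

lemma pair_graph_comet:
  assumes "0 < D" "D \<le> n"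
  shows "pair_graph (comet D n)"
proof
  show "finite (parcs (comet D n))"
    by (rule finite_subset[of _ "{..<n} \<times> {..<n}"]) (use parcs_comet[OF assms] in auto)
qed (use assms in \<open>auto simp: pverts_comet parcs_comet symmetric_def sym_def\<close>)

lemma undirected_tree_comet:
  assumes "0 < D" "D \<le> n"
  shows "undirected_tree (comet D n)"
proof (rule undirected_tree_if_unique_smaller_neighbour)
  show "\<exists>u<v. (v, u) \<in> parcs (comet D n)" if "v \<in> pverts (comet D n)" "0 < v" for v
    using that assms
    by (intro exI[of _ "min v D - 1"]) (auto simp: pverts_comet parcs_comet)
qed (use assms in \<open>auto simp: pair_graph_comet pverts_comet parcs_comet\<close>)

text \<open>
  The bound on \<open>n\<close> says that the number of pendant vertices satisfies \<open>n - D > D * D + 2\<close>, which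
  is what makes the lower bound \<open>2 * (n - D - 1)\<close> on the distance sum of any vertex but the hub
  exceed the upper bound \<open>D * D + (n - D)\<close> on the distance sum of the hub.
\<close>

locale large_comet =
  fixes D n :: nat
  assumes D: "2 \<le> D" and n: "D * D + D + 2 < n"
begin

lemma D_lt_n: "D < n" using n by simp

lemma
  shows pverts[simp]: "pverts (comet D n) = {..<n}"
    and parcs: "(a, b) \<in> parcs (comet D n) \<longleftrightarrow> a < n \<and> b < n \<and> (min b D = Suc a \<or> min a D = Suc b)"
  using pverts_comet[of D n] parcs_comet[of D n] D D_lt_n by auto

sublocale undirected_tree "comet D n"
  using undirected_tree_comet D D_lt_n by simp

lemma dist_ge_level:
  assumes "u < n" "v < n"
  shows "min u D \<le> min v D + d u v"
  using assms by (intro lipschitz_le_dist[where f = "\<lambda>v. min v D"]) (auto simp: parcs)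

text \<open>Along the parents of \<open>v\<close> the level drops by one in each step until it reaches \<open>i\<close>.\<close>

lemma dist_path_le:
  assumes "i < D" "i \<le> v" "v < n"
  shows "d i v \<le> min v D - i"
  using assms
proof (induction v rule: less_induct)
  case (less v)
  show ?case
  proof (cases "v = i")
    case True
    then show ?thesis using less.prems dist_self[of i] by simp
  next
    case False
    define u where "u = min v D - 1"
    have u: "u < v" "i \<le> u" "u < n" "u < D" "min v D = Suc u"
      using False less.prems D by (auto simp: u_def)
    then have "d i u \<le> u - i" using less.IH[of u] less.prems by simp
    moreover have "d u v \<le> 1" using u less.prems by (intro dist_arc_le) (auto simp: parcs)
    moreover have "d i v \<le> d i u + d u v" using u less.prems by (intro dist_triangle) auto
    ultimately show ?thesis using u by linarith
  qed
qed

lemma dist_path: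
  assumes "i < D" "i \<le> v" "v < n"
  shows "d i v = min v D - i" "d v i = min v D - i"
  using dist_path_le[OF assms] dist_ge_level[of v i] dist_sym[of v i] assms by auto

lemma dist_pendants:
  assumes "D \<le> u" "D \<le> v" "u < n" "v < n" "u \<noteq> v"
  shows "d u v = 2"
proof -
  obtain a where a: "(u, a) \<in> parcs (comet D n)" "d u v = Suc (d a v)"
    using ex_first_step[of u v] assms by auto
  then have "Suc a = D" using assms by (auto simp: parcs)
  then show ?thesis using dist_path(1)[of a v] a assms by auto
qed

lemma ecc_comet:
  assumes "v < n"
  shows "ecc (comet D n) v = max (min v D) (D - min v D)"
  unfolding ecc_def
proof (rule Max_eqI)
  show "finite {d v u |u. u \<in> pverts (comet D n)}" by simp
  have "d v u \<le> max (min v D) (D - min v D)" if "u < n" for u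
  proof -
    consider "v < D" "v \<le> u" | "u < D" "u \<le> v" | "D \<le> u" "D \<le> v" by linarith
    then show ?thesis
    proof cases
      case 3
      then show ?thesis using assms that dist_pendants[of v u] dist_self[of u] D by (cases "u = v") auto
    qed (use assms that dist_path in auto)
  qed
  then show "x \<le> max (min v D) (D - min v D)" if "x \<in> {d v u |u. u \<in> pverts (comet D n)}" for x
    using that by auto
  have "d v 0 = min v D" using dist_path(2)[of 0 v] assms D by simp
  moreover have "d v D = D - min v D" if "v < D" using dist_path(1)[of v D] assms that D_lt_n by simp
  ultimately have "max (min v D) (D - min v D) \<in> {d v 0, d v D}"
    by (cases "v < D") (auto simp: max_def)
  then show "max (min v D) (D - min v D) \<in> {d v u |u. u \<in> pverts (comet D n)}"
    using D_lt_n by force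
qed

lemma tree_diameter_le: "tree_diameter (comet D n) \<le> D"
proof -
  have "{d u v |u v. u \<in> pverts (comet D n) \<and> v \<in> pverts (comet D n)} \<noteq> {}"
    using D_lt_n by auto
  moreover have "d u v \<le> D" if "u < n" "v < n" for u v
    using dist_le_ecc[of v u] ecc_comet[OF that(1)] that by auto
  ultimately show ?thesis unfolding tree_diameter_def
    using finite_dists(2) by (subst Max_le_iff) auto
qed

lemma vertex_distance_hub: "vertex_distance (comet D n) (D - 1) \<le> D * D + (n - D)"
proof -
  have "sum (d (D - 1)) ({..<D} \<union> {D..<n}) = sum (d (D - 1)) {..<D} + sum (d (D - 1)) {D..<n}"
    by (rule sum.union_disjoint) auto
  moreover have "{..<D} \<union> {D..<n} = {..<n}" using D_lt_n by auto
  ultimately have "vertex_distance (comet D n) (D - 1) = (\<Sum>u<D. d (D - 1) u) + (\<Sum>u = D..<n. d (D - 1) u)"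
    by (simp add: vertex_distance_def)
  moreover have "(\<Sum>u<D. d (D - 1) u) \<le> (\<Sum>u<D. D)"
    using dist_path(2)[of _ "D - 1"] D_lt_n by (intro sum_mono) auto
  moreover have "(\<Sum>u = D..<n. d (D - 1) u) = (\<Sum>u = D..<n. 1)"
    using dist_path(1)[of "D - 1"] D by (intro sum.cong) auto
  ultimately show ?thesis by simp
qed

lemma vertex_distance_other:
  assumes "v < n" "v \<noteq> D - 1"
  shows "2 * (n - D - 1) \<le> vertex_distance (comet D n) v"
proof -
  have "2 \<le> d v u" if "u \<in> {D..<n} - {v}" for u
    using that assms dist_pendants[of v u] dist_path(1)[of v u] by (cases "v < D") auto
  then have "(\<Sum>u \<in> {D..<n} - {v}. 2) \<le> (\<Sum>u \<in> {D..<n} - {v}. d v u)"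
    by (rule sum_mono)
  also have "\<dots> \<le> vertex_distance (comet D n) v"
    unfolding vertex_distance_def by (rule sum_mono2) auto
  finally have "2 * card ({D..<n} - {v}) \<le> vertex_distance (comet D n) v" by simp
  moreover have "n - D - 1 \<le> card ({D..<n} - {v})"
    using diff_card_le_card_Diff[of "{v}" "{D..<n}"] by simp
  ultimately show ?thesis by linarith
qed

lemma centroid_comet: "centroid (comet D n) = {D - 1}"
proof -
  have hub: "vertex_distance (comet D n) (D - 1) < vertex_distance (comet D n) v"
    if "v < n" "v \<noteq> D - 1" for v
    using vertex_distance_hub vertex_distance_other[OF that] n by linarith
  have "v = D - 1" if "v \<in> centroid (comet D n)" for v
  proof (rule ccontr)
    assume "v \<noteq> D - 1"
    moreover have "v < n" "vertex_distance (comet D n) v \<le> vertex_distance (comet D n) (D - 1)"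
      using that D_lt_n by (auto simp: centroid_def)
    ultimately show False using hub[of v] by simp
  qed
  moreover have "D - 1 \<in> centroid (comet D n)"
  proof -
    have "vertex_distance (comet D n) (D - 1) \<le> vertex_distance (comet D n) v" if "v < n" for v
      using hub[OF that] by (cases "v = D - 1") auto
    then show ?thesis using D_lt_n by (auto simp: centroid_def)
  qed
  ultimately show ?thesis by blast
qed

lemma set_dist_center_centroid:
  "set_dist (comet D n) (center (comet D n)) (centroid (comet D n)) = (D - 2) div 2"
proof -
  \<comment> \<open>The vertex at level \<open>D / 2\<close> rounded up: of the one or two center vertices, the one nearest the
    hub.\<close>
  define k where "k = D - D div 2"
  have k: "k < D" "k < n" "ecc (comet D n) k = k"
    using D D_lt_n by (auto simp: k_def ecc_comet)
  have "k \<le> max l (D - l)" for l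
    by (cases "l \<le> D div 2") (simp_all add: k_def le_max_iff_disj)
  then have k_le: "k \<le> ecc (comet D n) v" if "v < n" for v
    using ecc_comet[OF that] by simp
  have kc: "k \<in> center (comet D n)" using k k_le by (simp add: center_def)
  have far: "D - 1 - k \<le> d c (D - 1)" if "c \<in> center (comet D n)" for c
  proof -
    have "c < n" "ecc (comet D n) c \<le> ecc (comet D n) k" using that k(2) by (auto simp: center_def)
    then have "min c D \<le> k" "c < n" using ecc_comet[of c] k(3) by auto
    moreover have "D - 1 < n" "min (D - 1) D = D - 1" using D_lt_n by auto
    ultimately show ?thesis using dist_ge_level[of "D - 1" c] dist_sym[of c "D - 1"] by simp
  qed
  have "set_dist (comet D n) (center (comet D n)) {D - 1} = D - 1 - k"
    unfolding set_dist_def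
  proof (rule Min_eqI)
    show "finite {d u v |u v. u \<in> center (comet D n) \<and> v \<in> {D - 1}}"
      by (rule finite_subset[OF _ finite_dists(2)]) (use less_imp_diff_less[OF D_lt_n] in \<open>auto simp: center_def\<close>)
    have "d k (D - 1) = D - 1 - k"
      using dist_path(1)[of k "D - 1"] k less_imp_diff_less[OF D_lt_n] by simp
    then show "D - 1 - k \<in> {d u v |u v. u \<in> center (comet D n) \<and> v \<in> {D - 1}}"
      using kc by (metis (mono_tags, lifting) mem_Collect_eq singletonI)
  qed (use far in auto)
  also have "D - 1 - k = (D - 2) div 2" using D unfolding k_def by arith
  finally show ?thesis by (simp add: centroid_comet)
qed

end

theorem proposition4p1:
  fixes D :: nat
  assumes "2 \<le> D"
  shows "\<exists>n\<^sub>0 :: nat. \<forall>n > n\<^sub>0.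
     (\<forall>T :: 'a pair_pre_digraph.
        simple_tree T \<longrightarrow> card (pverts T) = n \<longrightarrow> tree_diameter T \<le> D \<longrightarrow>
        set_dist T (center T) (centroid T) \<le> (D - 2) div 2) \<and>
     (simple_tree (comet D n) \<and> card (pverts (comet D n)) = n \<and> tree_diameter (comet D n) \<le> D \<and>
      set_dist (comet D n) (center (comet D n)) (centroid (comet D n)) = (D - 2) div 2)"
proof (intro exI[of _ "D * D + D + 2"] allI impI conjI)
  fix n assume n: "D * D + D + 2 < n"
  then interpret large_comet D n using assms by unfold_locales auto
  show "simple_tree (comet D n)" using undirected_tree_axioms by (simp add: undirected_tree_iff)
  show "card (pverts (comet D n)) = n" by simp
  show "tree_diameter (comet D n) \<le> D" by (rule tree_diameter_le)
  show "set_dist (comet D n) (center (comet D n)) (centroid (comet D n)) = (D - 2) div 2"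
    by (rule set_dist_center_centroid)
  fix T :: "'a pair_pre_digraph"
  assume "simple_tree T" "card (pverts T) = n" "tree_diameter T \<le> D"
  then show "set_dist T (center T) (centroid T) \<le> (D - 2) div 2"
    using n undirected_tree.set_dist_center_centroid_le[of T D] by (simp add: undirected_tree_iff)
qed

end
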